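(* Let $J\geq 1$ be an integer and let $0<a_1\leq a_2\leq\cdots\leq a_J$ and $0< b_1\leq b_2\leq\cdots\leq b_J$ be real numbers such that $\sum_{j=1}^{L}a_j\leq\sum_{j=1}^{L}b_j$ for each $L=1,2,\dots,J$. Then the sequence $(\mu_n)_{n\geq 0}$ defined by $$\mu_n=\frac{\prod_{j=1}^{J}\Gamma(n+a_j)}{\prod_{k=1}^{J}\Gamma(n+b_k)},\qquad n\geq 0,$$ is a Hausdorff moment sequence.
   Context: A sequence $(m_n)_{n\geq 0}$ is called a Hausdorff moment sequence if there exists a random variable $X$ taking values in a compact real interval such that $\mathbb{E}(X^n)=m_n/m_0$ for all $n\geq 0$. *)

theory Defs
  imports "HOL-Probability.Probability"
begin

(* HOL cannot quantify existentially over the type carrying the sample space, so the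
   sample space is taken on the type real. This loses no generality: a real random
   variable can be replaced by the identity on the real line under its distribution. *)
definition hausdorff_moment_sequence :: "(nat \<Rightarrow> real) \<Rightarrow> bool" where
  "hausdorff_moment_sequence m \<longleftrightarrow>
     (\<exists>(M :: real measure) (X :: real \<Rightarrow> real) (l :: real) (u :: real).
        prob_space M \<and> X \<in> borel_measurable M \<and>
        (\<forall>\<omega>\<in>space M. X \<omega> \<in> {l..u}) \<and>
        (\<forall>n. prob_space.expectation M (\<lambda>\<omega>. X \<omega> ^ n) = m n / m 0))"

end

theory Submission
  imports Defs
begin

text \<open>
  A sequence \<open>m\<close> with \<open>m 0 = 1\<close> consists of the moments of a law on
  \<open>[0, 1]\<close> exactly when the linear functional on polynomials sending \<open>t\<^sup>n\<close> to \<open>m n\<close> is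
  nonnegative on every polynomial that is nonnegative on \<open>[0, 1]\<close>. Below, a sequence with
  this property is called positive. Positivity is what the proof manipulates, because it visibly survives sums, products,
  exponentials and pointwise limits, whereas each of these would require a
  construction on the side of measures. A measure is produced only once, at the end,
  by \<open>moment_positive_imp_hausdorff\<close>.

  The Gamma ratio is brought within reach of these closure properties by Euler's product,
  which makes it a limit of positive constants times
  \<open>\<Prod>i\<le>N. \<Prod>j. (n + b\<^sub>j + i) / (n + a\<^sub>j + i)\<close>. Shifting all parameters by \<open>i\<close>
  preserves the hypotheses, so everything comes down to the single rational factor
  \<open>\<Prod>j. (n + b\<^sub>j) / (n + a\<^sub>j)\<close> (\<open>moment_positive_rational\<close>), and it suffices that its
  logarithm is positive. Write
  \<open>ln ((n + b) / (n + a))\<close> as \<open>(b - a) / (n + b)\<close> plus a remainder; this is the expansion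
  of \<open>- ln (n + a)\<close>, convex in the parameter \<open>a\<close>, around \<open>b\<close>. The remainder is
  positive whichever of \<open>a\<close> and \<open>b\<close> is larger (\<open>moment_positive_ln_remainder\<close>). The
  linear terms may have either sign, but their sum over \<open>j\<close> is positive by summation by
  parts, since the differences \<open>1 / (n + b\<^sub>j) - 1 / (n + b\<^sub>j\<^sub>+\<^sub>1)\<close> are positive sequences and
  the partial sums of \<open>b\<^sub>j - a\<^sub>j\<close> are nonnegative (\<open>moment_positive_Abel_sum\<close>). This is where majorization enters.
\<close>

section \<open>Sequences that are positive on nonnegative polynomials\<close>

text \<open>Polynomials are given by arbitrary coefficient functions, so that scaling the
  variable or multiplying the coefficients by another sequence needs no construction.\<close>

definition moment_positive :: "(nat \<Rightarrow> real) \<Rightarrow> bool" where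
  "moment_positive m \<longleftrightarrow>
     (\<forall>N c. (\<forall>t\<in>{0..1}. 0 \<le> (\<Sum>i\<le>N. c i * t ^ i)) \<longrightarrow> 0 \<le> (\<Sum>i\<le>N. c i * m i))"

lemma moment_positiveI:
  assumes "\<And>N c. (\<And>t. 0 \<le> t \<Longrightarrow> t \<le> 1 \<Longrightarrow> 0 \<le> (\<Sum>i\<le>N. c i * t ^ i)) \<Longrightarrow> 0 \<le> (\<Sum>i\<le>N. c i * m i)"
  shows "moment_positive m"
  using assms unfolding moment_positive_def by auto

lemma moment_positiveD:
  assumes "moment_positive m" "\<And>t. 0 \<le> t \<Longrightarrow> t \<le> 1 \<Longrightarrow> 0 \<le> (\<Sum>i\<le>N. c i * t ^ i)"
  shows "0 \<le> (\<Sum>i\<le>N. c i * m i)"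
  using assms unfolding moment_positive_def by auto

lemma moment_positive_const:
  assumes "0 \<le> r"
  shows "moment_positive (\<lambda>_. r)"
proof (rule moment_positiveI)
  fix N :: nat and c :: "nat \<Rightarrow> real"
  assume "\<And>t. 0 \<le> t \<Longrightarrow> t \<le> 1 \<Longrightarrow> 0 \<le> (\<Sum>i\<le>N. c i * t ^ i)"
  from this[of 1] have "0 \<le> (\<Sum>i\<le>N. c i)" by simp
  then show "0 \<le> (\<Sum>i\<le>N. c i * r)"
    using assms by (simp flip: sum_distrib_right)
qed

lemma moment_positive_add:
  assumes "moment_positive f" "moment_positive g"
  shows "moment_positive (\<lambda>n. f n + g n)"
proof (rule moment_positiveI)
  fix N :: nat and c :: "nat \<Rightarrow> real"
  assume "\<And>t. 0 \<le> t \<Longrightarrow> t \<le> 1 \<Longrightarrow> 0 \<le> (\<Sum>i\<le>N. c i * t ^ i)"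
  from moment_positiveD[OF assms(1) this] moment_positiveD[OF assms(2) this]
  show "0 \<le> (\<Sum>i\<le>N. c i * (f i + g i))"
    by (simp add: distrib_left sum.distrib)
qed

text \<open>For independent variables this would be the law of the product. In terms of
  polynomials: if \<open>p\<close> is nonnegative on \<open>[0, 1]\<close> then so is \<open>t \<mapsto> p (s t)\<close> for each \<open>s\<close> in
  \<open>[0, 1]\<close>. Applying the functional of \<open>f\<close> in the variable \<open>t\<close> leaves a polynomial in \<open>s\<close>
  that is nonnegative on \<open>[0, 1]\<close>, to which the functional of \<open>g\<close> applies.\<close>

lemma moment_positive_mult:
  assumes "moment_positive f" "moment_positive g"
  shows "moment_positive (\<lambda>n. f n * g n)"
proof (rule moment_positiveI)
  fix N :: nat and c :: "nat \<Rightarrow> real"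
  assume c: "\<And>t. 0 \<le> t \<Longrightarrow> t \<le> 1 \<Longrightarrow> 0 \<le> (\<Sum>i\<le>N. c i * t ^ i)"
  have "0 \<le> (\<Sum>i\<le>N. (c i * f i) * g i)"
  proof (rule moment_positiveD[OF assms(2)])
    fix s :: real assume s: "0 \<le> s" "s \<le> 1"
    have "0 \<le> (\<Sum>i\<le>N. (c i * s ^ i) * f i)"
    proof (rule moment_positiveD[OF assms(1)])
      fix t :: real assume t: "0 \<le> t" "t \<le> 1"
      have "0 \<le> (\<Sum>i\<le>N. c i * (s * t) ^ i)"
        using s t by (intro c) (auto intro: mult_le_one)
      then show "0 \<le> (\<Sum>i\<le>N. (c i * s ^ i) * t ^ i)"
        by (simp add: power_mult_distrib mult.assoc)
    qed
    then show "0 \<le> (\<Sum>i\<le>N. (c i * f i) * s ^ i)"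
      by (simp add: mult_ac)
  qed
  then show "0 \<le> (\<Sum>i\<le>N. c i * (f i * g i))"
    by (simp add: mult.assoc)
qed

lemma moment_positive_LIMSEQ:
  assumes "\<And>k. moment_positive (f k)" "\<And>n. (\<lambda>k. f k n) \<longlonglongrightarrow> g n"
  shows "moment_positive g"
proof (rule moment_positiveI)
  fix N :: nat and c :: "nat \<Rightarrow> real"
  assume c: "\<And>t. 0 \<le> t \<Longrightarrow> t \<le> 1 \<Longrightarrow> 0 \<le> (\<Sum>i\<le>N. c i * t ^ i)"
  have "(\<lambda>k. \<Sum>i\<le>N. c i * f k i) \<longlonglongrightarrow> (\<Sum>i\<le>N. c i * g i)"
    by (intro tendsto_intros assms(2))
  then show "0 \<le> (\<Sum>i\<le>N. c i * g i)"
    by (rule LIMSEQ_le_const) (use moment_positiveD[OF assms(1) c] in auto)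
qed

lemma moment_positive_sum:
  assumes "\<And>k. k \<in> A \<Longrightarrow> moment_positive (f k)"
  shows "moment_positive (\<lambda>n. \<Sum>k\<in>A. f k n)"
  using assms
  by (induction A rule: infinite_finite_induct)
     (simp_all add: moment_positive_const moment_positive_add)

lemma moment_positive_prod:
  assumes "\<And>k. k \<in> A \<Longrightarrow> moment_positive (f k)"
  shows "moment_positive (\<lambda>n. \<Prod>k\<in>A. f k n)"
  using assms
  by (induction A rule: infinite_finite_induct)
     (simp_all add: moment_positive_const moment_positive_mult)

lemma moment_positive_power:
  assumes "moment_positive f"
  shows "moment_positive (\<lambda>n. f n ^ k)"
  by (induction k) (simp_all add: moment_positive_const moment_positive_mult assms)

lemma moment_positive_cmult:
  assumes "0 \<le> r" "moment_positive f"
  shows "moment_positive (\<lambda>n. r * f n)"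
  by (intro moment_positive_mult moment_positive_const assms)

lemma moment_positive_power_series:
  assumes "moment_positive f" "\<And>k. 0 \<le> r k" "\<And>n. (\<lambda>k. r k * f n ^ k) sums g n"
  shows "moment_positive g"
proof (rule moment_positive_LIMSEQ)
  show "moment_positive (\<lambda>n. \<Sum>k<K. r k * f n ^ k)" for K
    by (intro moment_positive_sum moment_positive_cmult moment_positive_power assms)
  show "(\<lambda>K. \<Sum>k<K. r k * f n ^ k) \<longlonglongrightarrow> g n" for n
    using assms(3) by (simp add: sums_def)
qed

lemma moment_positive_exp:
  assumes "moment_positive f"
  shows "moment_positive (\<lambda>n. exp (f n))"
  by (rule moment_positive_power_series[OF assms, where r = "\<lambda>k. 1 / fact k"])
     (use exp_converges[where 'a = real] in \<open>simp_all add: field_simps\<close>)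

text \<open>These are the moments of the density \<open>t\<^sup>a\<^sup>-\<^sup>1\<close> on \<open>[0, 1]\<close>. The value of the functional
  on \<open>p\<close> is the increment over \<open>[0, 1]\<close> of an antiderivative \<open>F\<close> of \<open>p t * t\<^sup>a\<^sup>-\<^sup>1\<close>, and \<open>F\<close>
  is increasing.\<close>

lemma moment_positive_inverse_shift:
  assumes "0 < (a::real)"
  shows "moment_positive (\<lambda>n. 1 / (real n + a))"
proof (rule moment_positiveI)
  fix N :: nat and c :: "nat \<Rightarrow> real"
  assume c: "\<And>t. 0 \<le> t \<Longrightarrow> t \<le> 1 \<Longrightarrow> 0 \<le> (\<Sum>i\<le>N. c i * t ^ i)"
  define F where "F t = (\<Sum>i\<le>N. c i * (t powr (real i + a) / (real i + a)))" for t
  have "F 0 \<le> F 1"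
  proof (rule DERIV_nonneg_imp_increasing_open[where f = F])
    fix t :: real assume t: "0 < t" "t < 1"
    have pos: "0 < real i + a" for i using assms by linarith
    have eq: "t powr (real i + a - 1) = t ^ i * t powr (a - 1)" for i
      using t by (simp add: powr_realpow powr_add[symmetric] add_diff_eq flip: powr_realpow)
    have d: "((\<lambda>t. t powr (real i + a) / (real i + a)) has_real_derivative t powr (real i + a - 1)) (at t)" for i
      using DERIV_cdivide[OF has_real_derivative_powr[OF t(1), of "real i + a"], of "real i + a"] pos[of i]
      by simp
    have "(F has_real_derivative (\<Sum>i\<le>N. c i * t powr (real i + a - 1))) (at t)"
      unfolding F_def by (intro DERIV_sum DERIV_cmult d)
    moreover have "(\<Sum>i\<le>N. c i * t powr (real i + a - 1)) = (\<Sum>i\<le>N. c i * t ^ i) * t powr (a - 1)"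
      unfolding eq by (simp add: sum_distrib_right mult.assoc)
    moreover have "0 \<le> (\<Sum>i\<le>N. c i * t ^ i) * t powr (a - 1)"
      using c t by simp
    ultimately show "\<exists>y. (F has_real_derivative y) (at t) \<and> 0 \<le> y" by auto
  next
    show "continuous_on {0..1} F"
      unfolding F_def using assms
      by (intro continuous_intros continuous_on_powr') (auto intro: add_nonneg_pos)
  qed simp
  then show "0 \<le> (\<Sum>i\<le>N. c i * (1 / (real i + a)))"
    by (simp add: F_def)
qed

section \<open>Rational functions and ratios of Gamma functions\<close>

text \<open>The remainder is a power series with nonnegative coefficients in a positive
  sequence. For \<open>a \<le> b\<close> put \<open>u = (b - a) / (n + b)\<close>, so that the remainder is
  \<open>- ln (1 - u) - u\<close>, the sum of \<open>u\<^sup>k / k\<close> over \<open>k \<ge> 2\<close>. For \<open>b < a\<close> the same quantity would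
  be negative and possibly large, so one uses \<open>w = (a - b) / (n + a)\<close> instead, which lies
  in \<open>[0, 1)\<close>: the remainder is then \<open>ln (1 - w) + w / (1 - w)\<close>, the sum of
  \<open>(1 - 1 / k) w\<^sup>k\<close> over \<open>k \<ge> 1\<close>.\<close>

lemma moment_positive_ln_remainder:
  assumes a: "0 < (a::real)" and b: "0 < b"
  shows "moment_positive (\<lambda>n. ln ((real n + b) / (real n + a)) - (b - a) / (real n + b))"
proof (cases "a \<le> b")
  case True
  define u where "u n = (b - a) * (1 / (real n + b))" for n
  have u: "moment_positive u" unfolding u_def
    by (intro moment_positive_cmult moment_positive_inverse_shift) (use True b in auto)
  show ?thesis
  proof (rule moment_positive_power_series[OF u, where r = "\<lambda>k. if k \<le> 1 then 0 else 1 / real k"])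
    fix n
    have pos: "0 < real n + a" "0 < real n + b" using a b by linarith+
    have "0 \<le> u n" "u n < 1" using pos True a by (auto simp: u_def field_simps)
    then have s: "(\<lambda>k. - (u n ^ k) / real k) sums ln (1 - u n)"
      using ln_series'[of "- u n"] by simp
    have "(\<lambda>k. - (- (u n ^ k) / real k) - (if k = 1 then u n else 0)) sums (- ln (1 - u n) - u n)"
      by (intro sums_diff sums_minus s sums_single)
    moreover have "- (- (u n ^ k) / real k) - (if k = 1 then u n else 0)
        = (if k \<le> 1 then 0 else 1 / real k) * u n ^ k" for k
      by (cases "k = 0"; cases "k = 1") auto
    moreover have "1 - u n = inverse ((real n + b) / (real n + a))"
      using pos by (simp add: u_def field_simps)
    then have "- ln (1 - u n) = ln ((real n + b) / (real n + a))"
      using pos by (simp only: ln_inverse divide_pos_pos)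
    ultimately show "(\<lambda>k. (if k \<le> 1 then 0 else 1 / real k) * u n ^ k) sums
        (ln ((real n + b) / (real n + a)) - (b - a) / (real n + b))"
      by (simp add: u_def)
  qed auto
next
  case False
  define w where "w n = (a - b) * (1 / (real n + a))" for n
  have w: "moment_positive w" unfolding w_def
    by (intro moment_positive_cmult moment_positive_inverse_shift) (use False a in auto)
  show ?thesis
  proof (rule moment_positive_power_series[OF w, where r = "\<lambda>k. if k = 0 then 0 else 1 - 1 / real k"])
    fix n
    have pos: "0 < real n + a" "0 < real n + b" using a b by linarith+
    have w01: "0 \<le> w n" "w n < 1" using pos False b by (auto simp: w_def field_simps)
    then have s: "(\<lambda>k. - (w n ^ k) / real k) sums ln (1 - w n)"
      using ln_series'[of "- w n"] by simp
    have g: "(\<lambda>k. w n ^ k) sums (1 / (1 - w n))"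
      using w01 by (intro geometric_sums) simp
    have "(\<lambda>k. - (w n ^ k) / real k + (w n ^ k - (if k = 0 then 1 else 0))) sums
        (ln (1 - w n) + (1 / (1 - w n) - 1))"
      by (intro sums_diff sums_add s g sums_single)
    moreover have "- (w n ^ k) / real k + (w n ^ k - (if k = 0 then 1 else 0))
        = (if k = 0 then 0 else 1 - 1 / real k) * w n ^ k" for k
      by (auto simp: field_simps)
    moreover have e: "1 - w n = (real n + b) / (real n + a)"
      using pos by (simp add: w_def field_simps)
    moreover have "1 / (1 - w n) - 1 = - ((b - a) / (real n + b))"
      unfolding e using pos by (simp add: field_simps)
    ultimately show "(\<lambda>k. (if k = 0 then 0 else 1 - 1 / real k) * w n ^ k) sums
        (ln ((real n + b) / (real n + a)) - (b - a) / (real n + b))"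
      by simp
  qed auto
qed

text \<open>Summation by parts writes the sum as a combination, with the nonnegative partial
  sums of \<open>c\<close> as coefficients, of the differences
  \<open>1 / (n + b\<^sub>L) - 1 / (n + b\<^sub>L\<^sub>+\<^sub>1) = (b\<^sub>L\<^sub>+\<^sub>1 - b\<^sub>L) / ((n + b\<^sub>L) (n + b\<^sub>L\<^sub>+\<^sub>1))\<close> and of the last
  term \<open>1 / (n + b\<^sub>J)\<close>; all of these are positive sequences.\<close>

lemma moment_positive_Abel_sum:
  fixes b c :: "nat \<Rightarrow> real"
  assumes mono: "mono_on {1..J} b" and pos: "\<And>j. j \<in> {1..J} \<Longrightarrow> 0 < b j"
    and partial: "\<And>L. L \<in> {1..J} \<Longrightarrow> 0 \<le> (\<Sum>j=1..L. c j)"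
  shows "moment_positive (\<lambda>n. \<Sum>j=1..J. c j / (real n + b j))"
proof (cases "J = 0")
  case False
  \<comment> \<open>Without its boundary term the sum by parts telescopes step by step; the boundary term is
    added back at the end, for \<open>L = J\<close>.\<close>
  have "moment_positive (\<lambda>n. (\<Sum>j=1..L. c j / (real n + b j)) - (\<Sum>j=1..L. c j) / (real n + b L))"
    if "1 \<le> L" "L \<le> J" for L
    using that
  proof (induction L rule: dec_induct)
    case base
    show ?case by (simp add: moment_positive_const)
  next
    case (step L)
    define S where "S = (\<Sum>j=1..L. c j)"
    have b: "0 < b L" "0 < b (Suc L)" using pos step by auto
    have le: "b L \<le> b (Suc L)"
      using step by (intro mono_onD[OF mono]) auto
    have S: "0 \<le> S" using partial step by (simp add: S_def)
    have "moment_positive (\<lambda>n. ((\<Sum>j=1..L. c j / (real n + b j)) - S / (real n + b L))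
      + S * (b (Suc L) - b L) * (1 / (real n + b L) * (1 / (real n + b (Suc L)))))"
      unfolding S_def
      using step b le S
      by (intro moment_positive_add moment_positive_cmult moment_positive_mult
            moment_positive_inverse_shift) (auto simp: S_def)
    moreover have "((\<Sum>j=1..L. c j / (real n + b j)) - S / (real n + b L))
      + S * (b (Suc L) - b L) * (1 / (real n + b L) * (1 / (real n + b (Suc L))))
      = (\<Sum>j=1..Suc L. c j / (real n + b j)) - (\<Sum>j=1..Suc L. c j) / (real n + b (Suc L))" for n
    proof -
      have p: "0 < real n + b L" "0 < real n + b (Suc L)" using b by linarith+
      have "S * (b (Suc L) - b L) * (1 / (real n + b L) * (1 / (real n + b (Suc L))))
        = S / (real n + b L) - S / (real n + b (Suc L))"
        using p by (simp add: field_simps)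
      moreover have "(\<Sum>j=1..Suc L. c j) = S + c (Suc L)"
        by (simp add: S_def)
      ultimately show ?thesis
        by (simp add: add_divide_distrib)
    qed
    ultimately show ?case by (simp only:)
  qed
  from this[of J] have A: "moment_positive (\<lambda>n. (\<Sum>j=1..J. c j / (real n + b j)) - (\<Sum>j=1..J. c j) / (real n + b J))"
    using False by simp
  have B: "moment_positive (\<lambda>n. (\<Sum>j=1..J. c j) * (1 / (real n + b J)))"
    using False pos[of J] partial[of J]
    by (intro moment_positive_cmult moment_positive_inverse_shift) auto
  show ?thesis using moment_positive_add[OF A B] by simp
qed (simp add: moment_positive_const)

lemma moment_positive_rational:
  fixes a b :: "nat \<Rightarrow> real"
  assumes "mono_on {1..J} b" and b: "\<And>j. j \<in> {1..J} \<Longrightarrow> 0 < b j"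
    and a: "\<And>j. j \<in> {1..J} \<Longrightarrow> 0 < a j"
    and partial: "\<And>L. L \<in> {1..J} \<Longrightarrow> (\<Sum>j=1..L. a j) \<le> (\<Sum>j=1..L. b j)"
  shows "moment_positive (\<lambda>n. \<Prod>j=1..J. (real n + b j) / (real n + a j))"
proof -
  have "moment_positive (\<lambda>n. exp ((\<Sum>j=1..J. (b j - a j) / (real n + b j))
     + (\<Sum>j=1..J. ln ((real n + b j) / (real n + a j)) - (b j - a j) / (real n + b j))))"
    by (intro moment_positive_exp moment_positive_add moment_positive_Abel_sum
        moment_positive_sum moment_positive_ln_remainder)
       (use assms in \<open>auto simp: sum_subtractf\<close>)
  moreover have "exp ((\<Sum>j=1..J. (b j - a j) / (real n + b j))
     + (\<Sum>j=1..J. ln ((real n + b j) / (real n + a j)) - (b j - a j) / (real n + b j)))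
     = (\<Prod>j=1..J. (real n + b j) / (real n + a j))" for n
  proof -
    have "exp (ln ((real n + b j) / (real n + a j))) = (real n + b j) / (real n + a j)"
      if "j \<in> {1..J}" for j
      using a[OF that] b[OF that] by (intro exp_ln divide_pos_pos) linarith+
    then show ?thesis
      by (simp add: sum.distrib[symmetric] exp_sum)
  qed
  ultimately show ?thesis by simp
qed

text \<open>The factorials in Euler's limit formula cancel between numerator and denominator,
  because both have the same number of factors, and so does the dependence on \<open>n\<close> in the
  powers of \<open>N\<close>. What is left in front of the rational factors is the constant \<open>K N\<close>.\<close>

lemma moment_positive_Gamma_ratio:
  fixes a b :: "nat \<Rightarrow> real"
  assumes mono: "mono_on {1..J} b" and b: "\<And>j. j \<in> {1..J} \<Longrightarrow> 0 < b j"
    and a: "\<And>j. j \<in> {1..J} \<Longrightarrow> 0 < a j"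
    and partial: "\<And>L. L \<in> {1..J} \<Longrightarrow> (\<Sum>j=1..L. a j) \<le> (\<Sum>j=1..L. b j)"
  shows "moment_positive
    (\<lambda>n. (\<Prod>j=1..J. Gamma (real n + a j)) / (\<Prod>k=1..J. Gamma (real n + b k)))"
proof (rule moment_positive_LIMSEQ)
  define K where "K N = (\<Prod>j=1..J. exp ((a j - b j) * ln (real N)))" for N
  show "moment_positive (\<lambda>n. K N * (\<Prod>i\<in>{0..N}. \<Prod>j=1..J. (real n + (b j + real i)) / (real n + (a j + real i))))" for N
  proof (rule moment_positive_cmult[OF _ moment_positive_prod[OF moment_positive_rational]])
    show "0 \<le> K N" by (auto simp: K_def intro: prod_nonneg)
    show "mono_on {1..J} (\<lambda>j. b j + real i)" for i
      using mono by (auto simp: mono_on_def)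
  qed (use a b partial in \<open>auto simp: sum.distrib add_pos_nonneg\<close>)
  fix n
  have lim: "(\<lambda>N. (\<Prod>j=1..J. Gamma_series (real n + a j) N) / (\<Prod>k=1..J. Gamma_series (real n + b k) N))
    \<longlonglongrightarrow> (\<Prod>j=1..J. Gamma (real n + a j)) / (\<Prod>k=1..J. Gamma (real n + b k))"
  proof (intro tendsto_divide tendsto_prod Gamma_series_LIMSEQ)
    have "Gamma (real n + b k) \<noteq> 0" if "k \<in> {1..J}" for k
      using Gamma_real_pos[OF add_nonneg_pos[OF of_nat_0_le_iff b[OF that]], of n] by linarith
    then show "(\<Prod>k=1..J. Gamma (real n + b k)) \<noteq> 0" by simp
  qed
  have "(\<Prod>j=1..J. Gamma_series (real n + a j) N) / (\<Prod>k=1..J. Gamma_series (real n + b k) N)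
    = K N * (\<Prod>i\<in>{0..N}. \<Prod>j=1..J. (real n + (b j + real i)) / (real n + (a j + real i)))" for N
  proof -
    have "Gamma_series (real n + a j) N / Gamma_series (real n + b j) N
      = exp ((a j - b j) * ln (real N)) * (\<Prod>i\<in>{0..N}. (real n + (b j + real i)) / (real n + (a j + real i)))"
      if "j \<in> {1..J}" for j
    proof -
      have "exp ((real n + a j) * ln (real N)) / exp ((real n + b j) * ln (real N)) = exp ((a j - b j) * ln (real N))"
        by (simp add: exp_diff[symmetric] algebra_simps)
      moreover have "Gamma_series (real n + a j) N / Gamma_series (real n + b j) N
        = (exp ((real n + a j) * ln (real N)) / exp ((real n + b j) * ln (real N))) *
          (pochhammer (real n + b j) (Suc N) / pochhammer (real n + a j) (Suc N))"
        by (simp add: Gamma_series_def)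
      ultimately show ?thesis
        by (simp only: pochhammer_Suc_prod prod_dividef add.assoc)
    qed
    then have "(\<Prod>j=1..J. Gamma_series (real n + a j) N / Gamma_series (real n + b j) N)
      = (\<Prod>j=1..J. exp ((a j - b j) * ln (real N)) * (\<Prod>i\<in>{0..N}. (real n + (b j + real i)) / (real n + (a j + real i))))"
      by (intro prod.cong refl) auto
    then show ?thesis
      unfolding K_def by (subst prod.swap) (simp only: prod.distrib prod_dividef)
  qed
  with lim show "(\<lambda>N. K N * (\<Prod>i\<in>{0..N}. \<Prod>j=1..J. (real n + (b j + real i)) / (real n + (a j + real i))))
    \<longlonglongrightarrow> (\<Prod>j=1..J. Gamma (real n + a j)) / (\<Prod>k=1..J. Gamma (real n + b k))"
    by simp
qed

section \<open>Hausdorff's theorem\<close>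

definition moment_functional :: "(nat \<Rightarrow> real) \<Rightarrow> real poly \<Rightarrow> real" where
  "moment_functional m p = (\<Sum>i\<le>degree p. coeff p i * m i)"

lemma moment_functional_altdef:
  assumes "degree p \<le> d"
  shows "moment_functional m p = (\<Sum>i\<le>d. coeff p i * m i)"
  unfolding moment_functional_def
  by (rule sum.mono_neutral_left) (use assms in \<open>auto simp: coeff_eq_0\<close>)

lemma moment_functional_add:
  "moment_functional m (p + q) = moment_functional m p + moment_functional m q"
proof -
  define d where "d = max (degree p) (degree q)"
  have "degree (p + q) \<le> d" "degree p \<le> d" "degree q \<le> d"
    by (auto simp: d_def degree_add_le)
  then show ?thesis
    by (simp add: moment_functional_altdef[where d = d] distrib_right sum.distrib)
qed

lemma moment_functional_smult:
  "moment_functional m (smult r p) = r * moment_functional m p"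
  by (simp add: moment_functional_altdef[where d = "degree p"] sum_distrib_left mult.assoc)

lemma moment_functional_diff:
  "moment_functional m (p - q) = moment_functional m p - moment_functional m q"
  using moment_functional_add[of m p "smult (-1) q"] moment_functional_smult[of m "-1" q] by simp

lemma moment_functional_sum:
  "moment_functional m (\<Sum>k\<in>A. f k) = (\<Sum>k\<in>A. moment_functional m (f k))"
  by (induction A rule: infinite_finite_induct)
     (simp_all add: moment_functional_add, simp_all add: moment_functional_def)

lemma moment_functional_monom: "moment_functional m (monom r n) = r * m n"
proof -
  have "moment_functional m (monom r n) = (\<Sum>i\<le>n. if i = n then r * m n else 0)"
    unfolding moment_functional_altdef[OF degree_monom_le]
    by (intro sum.cong) auto
  then show ?thesis by simp
qed

lemma moment_functional_one: "moment_functional m 1 = m 0"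
  by (simp add: moment_functional_def)

lemma moment_functional_nonneg:
  assumes "moment_positive m" "\<And>t. 0 \<le> t \<Longrightarrow> t \<le> 1 \<Longrightarrow> 0 \<le> poly p t"
  shows "0 \<le> moment_functional m p"
  unfolding moment_functional_def
  by (rule moment_positiveD[OF assms(1)]) (use assms(2) in \<open>simp add: poly_altdef\<close>)

text \<open>The constant polynomial \<open>e\<close> dominates \<open>p\<close> and \<open>- p\<close> on \<open>[0, 1]\<close>, so positivity makes the
  functional continuous for the uniform norm.\<close>

lemma moment_functional_bound:
  assumes "moment_positive m" "\<And>t. 0 \<le> t \<Longrightarrow> t \<le> 1 \<Longrightarrow> \<bar>poly p t\<bar> \<le> e"
  shows "\<bar>moment_functional m p\<bar> \<le> e * m 0"
proof -
  have "0 \<le> moment_functional m (monom e 0 - p)" "0 \<le> moment_functional m (monom e 0 + p)"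
    using assms(2) by (intro moment_functional_nonneg assms(1); fastforce simp: poly_monom abs_le_iff)+
  then show ?thesis
    by (simp add: moment_functional_diff moment_functional_add moment_functional_monom)
qed

definition Bernstein_poly :: "nat \<Rightarrow> nat \<Rightarrow> real poly" where
  "Bernstein_poly N k = smult (of_nat (N choose k)) ([:0, 1:] ^ k * [:1, -1:] ^ (N - k))"

lemma poly_Bernstein_poly: "poly (Bernstein_poly N k) t = Bernstein N k t"
  by (simp add: Bernstein_poly_def Bernstein_def poly_power)

lemma sum_Bernstein_poly: "(\<Sum>k\<le>N. Bernstein_poly N k) = 1"
  by (rule poly_eq_poly_eq_iff[THEN iffD1], rule ext)
     (simp add: poly_sum poly_Bernstein_poly)

definition clamp01 :: "real \<Rightarrow> real" where
  "clamp01 x = max 0 (min 1 x)"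

text \<open>The Bernstein polynomials of degree \<open>N\<close> are nonnegative on \<open>[0, 1]\<close> and sum to \<open>1\<close>, so
  their values under the functional are the weights of a law on the points \<open>k / N\<close>. Its
  \<open>n\<close>-th moment is the functional applied to the Bernstein approximation of \<open>t\<^sup>n\<close>, which
  tends to \<open>m n\<close> by \<open>Bernstein_Weierstrass\<close> and \<open>moment_functional_bound\<close>. Helly's theorem
  provides a weakly convergent subsequence, and moments pass to the limit.

  The moments are taken of the truncation \<open>clamp01\<close> rather than of the identity: powers of
  \<open>clamp01\<close> are bounded continuous functions on the whole line, as weak convergence
  demands, and the random variable takes its values in \<open>[0, 1]\<close> without any discussion of
  the support of the limit law.\<close>

lemma moment_positive_imp_hausdorff_normalized:
  assumes pos: "moment_positive m" and m0: "m 0 = 1"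
  shows "hausdorff_moment_sequence m"
proof -
  define w where "w N k = (if k \<le> N then moment_functional m (Bernstein_poly N k) else 0)" for N k
  define \<mu> where "\<mu> N = distr (measure_pmf (embed_pmf (w N))) borel (\<lambda>k. real k / real N)" for N
  have w_nonneg: "0 \<le> w N k" for N k
    unfolding w_def
    by (auto intro!: moment_functional_nonneg[OF pos] simp: poly_Bernstein_poly Bernstein_nonneg)
  have w_sum: "(\<Sum>k\<le>N. w N k) = 1" for N
    by (simp add: w_def sum_Bernstein_poly moment_functional_one m0 flip: moment_functional_sum)
  have w_total: "(\<integral>\<^sup>+ k. ennreal (w N k) \<partial>count_space UNIV) = 1" for N
  proof -
    have "(\<integral>\<^sup>+ k. ennreal (w N k) \<partial>count_space UNIV) = (\<Sum>k\<le>N. ennreal (w N k))"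
      by (rule nn_integral_count_space') (auto simp: w_def)
    also have "\<dots> = 1" by (simp add: sum_ennreal w_nonneg w_sum)
    finally show ?thesis .
  qed
  have pmf_w: "pmf (embed_pmf (w N)) k = w N k" for N k
    by (rule pmf_embed_pmf[OF w_nonneg w_total])
  have set_w: "set_pmf (embed_pmf (w N)) \<subseteq> {..N}" for N
    by (auto simp: set_pmf_eq pmf_w w_def split: if_splits)
  have distr_\<mu>: "real_distribution (\<mu> N)" for N
    unfolding \<mu>_def by (rule prob_space.real_distribution_distr[OF prob_space_measure_pmf]) simp
  \<comment> \<open>This covers \<open>N = 0\<close>: division by zero gives the point 0.\<close>
  have unit: "real k / real N \<in> {0..1}" if "k \<le> N" for k N
    using that by (auto simp: divide_le_eq)
  have integral_\<mu>: "integral\<^sup>L (\<mu> N) (\<lambda>x. clamp01 x ^ n)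
      = moment_functional m (\<Sum>k\<le>N. smult ((real k / real N) ^ n) (Bernstein_poly N k))" for N n
  proof -
    have "integral\<^sup>L (\<mu> N) (\<lambda>x. clamp01 x ^ n)
        = measure_pmf.expectation (embed_pmf (w N)) (\<lambda>k. clamp01 (real k / real N) ^ n)"
      unfolding \<mu>_def clamp01_def by (rule integral_distr) measurable
    also have "\<dots> = (\<Sum>k\<le>N. clamp01 (real k / real N) ^ n * w N k)"
      using set_w by (subst integral_measure_pmf_real[where A = "{..N}"]) (auto simp: pmf_w)
    also have "\<dots> = (\<Sum>k\<le>N. (real k / real N) ^ n * moment_functional m (Bernstein_poly N k))"
      using unit by (intro sum.cong) (simp_all add: w_def clamp01_def)
    finally show ?thesis by (simp add: moment_functional_sum moment_functional_smult)
  qed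
  have moments: "(\<lambda>N. integral\<^sup>L (\<mu> N) (\<lambda>x. clamp01 x ^ n)) \<longlonglongrightarrow> m n" for n
  proof (rule LIMSEQ_I)
    fix e :: real assume e: "0 < e"
    have "continuous_on {0..1} (\<lambda>x::real. x ^ n)" by (intro continuous_intros)
    from Bernstein_Weierstrass[OF this, of "e / 2"] e obtain N0 where
      N0: "\<And>N x. N0 \<le> N \<Longrightarrow> x \<in> {0..1} \<Longrightarrow> \<bar>x ^ n - (\<Sum>k\<le>N. (real k / real N) ^ n * Bernstein N k x)\<bar> < e / 2"
      by auto
    have "norm (integral\<^sup>L (\<mu> N) (\<lambda>x. clamp01 x ^ n) - m n) < e" if "N0 \<le> N" for N
    proof -
      define p where "p = monom 1 n - (\<Sum>k\<le>N. smult ((real k / real N) ^ n) (Bernstein_poly N k))"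
      have "\<bar>moment_functional m p\<bar> \<le> e / 2 * m 0"
      proof (rule moment_functional_bound[OF pos])
        fix t :: real assume "0 \<le> t" "t \<le> 1"
        with N0[OF that, of t] show "\<bar>poly p t\<bar> \<le> e / 2"
          by (simp add: p_def poly_monom poly_sum poly_Bernstein_poly)
      qed
      moreover have "moment_functional m p = m n - integral\<^sup>L (\<mu> N) (\<lambda>x. clamp01 x ^ n)"
        by (simp add: p_def moment_functional_diff moment_functional_monom integral_\<mu>)
      ultimately show ?thesis
        using e m0 by (simp add: abs_minus_commute)
    qed
    then show "\<exists>no. \<forall>N\<ge>no. norm (integral\<^sup>L (\<mu> N) (\<lambda>x. clamp01 x ^ n) - m n) < e" by blast
  qed
  \<comment> \<open>One interval carries all the mass of every \<open>\<mu> N\<close>; tightness asks for intervals that are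
    open on the left, so it has to start below 0.\<close>
  have mass: "measure (\<mu> N) {-1<..1} = 1" for N
  proof -
    have "measure (\<mu> N) {-1<..1} = measure (measure_pmf (embed_pmf (w N))) ((\<lambda>k. real k / real N) -` {-1<..1})"
      unfolding \<mu>_def by (subst measure_distr) auto
    also have "\<dots> = 1"
    proof (rule measure_pmf.prob_eq_1[THEN iffD2])
      show "AE k in embed_pmf (w N). k \<in> (\<lambda>k. real k / real N) -` {-1<..1}"
        unfolding AE_measure_pmf_iff
      proof
        fix k assume "k \<in> set_pmf (embed_pmf (w N))"
        then have "k \<le> N" using set_w by blast
        from unit[OF this] have "0 \<le> real k / real N" "real k / real N \<le> 1" by simp_all
        then show "k \<in> (\<lambda>k. real k / real N) -` {-1<..1}"
          unfolding vimage_eq greaterThanAtMost_iff by linarith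
      qed
    qed simp
    finally show ?thesis .
  qed
  have "tight \<mu>"
    unfolding tight_def
    by (intro conjI allI impI distr_\<mu> exI[where x = "-1"] exI[where x = 1]) (simp_all add: mass)
  from tight_imp_convergent_subsubsequence[OF this strict_mono_id]
  obtain r M where r: "strict_mono r" and M: "real_distribution M"
    and conv: "weak_conv_m (\<mu> \<circ> r) M" by auto
  interpret M: real_distribution M by (rule M)
  have expectation: "integral\<^sup>L M (\<lambda>x. clamp01 x ^ n) = m n" for n
  proof (rule LIMSEQ_unique)
    show "(\<lambda>N. integral\<^sup>L ((\<mu> \<circ> r) N) (\<lambda>x. clamp01 x ^ n)) \<longlonglongrightarrow> integral\<^sup>L M (\<lambda>x. clamp01 x ^ n)"
    proof (rule weak_conv_imp_integral_bdd_continuous_conv[OF _ M conv, where B = 1])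
      show "isCont (\<lambda>x. clamp01 x ^ n) x" for x
        unfolding clamp01_def by (intro continuous_intros)
      show "norm (clamp01 x ^ n) \<le> 1" for x
        by (auto simp: clamp01_def intro!: power_le_one)
    qed (simp add: distr_\<mu>)
    show "(\<lambda>N. integral\<^sup>L ((\<mu> \<circ> r) N) (\<lambda>x. clamp01 x ^ n)) \<longlonglongrightarrow> m n"
      using LIMSEQ_subseq_LIMSEQ[OF moments r] by (simp add: o_def)
  qed
  show ?thesis
    unfolding hausdorff_moment_sequence_def
  proof (intro exI conjI)
    show "prob_space M" by (rule M.prob_space_axioms)
    show "clamp01 \<in> borel_measurable M" unfolding clamp01_def by measurable
    show "\<forall>x\<in>space M. clamp01 x \<in> {0..1}" by (auto simp: clamp01_def)
    show "\<forall>n. integral\<^sup>L M (\<lambda>x. clamp01 x ^ n) = m n / m 0" by (simp add: expectation m0)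
  qed
qed

lemma moment_positive_imp_hausdorff:
  assumes "moment_positive m" and m0: "0 < m 0"
  shows "hausdorff_moment_sequence m"
proof -
  have "moment_positive (\<lambda>n. 1 / m 0 * m n)"
    using assms by (intro moment_positive_cmult) auto
  then have "hausdorff_moment_sequence (\<lambda>n. 1 / m 0 * m n)"
    by (rule moment_positive_imp_hausdorff_normalized) (use m0 in simp)
  then show ?thesis
    using m0 by (simp add: hausdorff_moment_sequence_def)
qed

theorem proposition3p1:
  fixes J :: nat and a b :: "nat \<Rightarrow> real"
  assumes "J \<ge> 1"
    and "0 < a 1" and "mono_on {1..J} a"
    and "0 < b 1" and "mono_on {1..J} b"
    and "\<And>L. L \<in> {1..J} \<Longrightarrow> (\<Sum>j=1..L. a j) \<le> (\<Sum>j=1..L. b j)"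
  shows "hausdorff_moment_sequence
    (\<lambda>n. (\<Prod>j=1..J. Gamma (real n + a j)) / (\<Prod>k=1..J. Gamma (real n + b k)))"
    (is "hausdorff_moment_sequence ?\<mu>")
proof -
  have a: "0 < a j" if "j \<in> {1..J}" for j
    using mono_onD[OF assms(3), of 1 j] that assms(2) by auto
  have b: "0 < b j" if "j \<in> {1..J}" for j
    using mono_onD[OF assms(5), of 1 j] that assms(4) by auto
  have \<mu>0: "0 < ?\<mu> 0"
    using a b by (intro divide_pos_pos prod_pos) auto
  have "moment_positive ?\<mu>"
    by (rule moment_positive_Gamma_ratio[OF assms(5) b a assms(6)])
  then show ?thesis
    using \<mu>0 by (rule moment_positive_imp_hausdorff)
qed

end
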